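(* Let $\Delta$ be a connected loop-free bigraph with vertex set $\{1,\dots,n\}$, $n\geq 1$, given by its integers $d_{ij}=d_{ji}$ ($i\neq j$). Consider the following algorithm InflationsToPosSincereRoot$(\Delta)$: 1. set $S:=\{1\}$; 2. while $|S|<n$: choose $(a,b)\in S\times(\{1,\dots,n\}\setminus S)$ such that $d_{ab}\neq 0$ in the current bigraph $\Delta$; if $d_{ab}<0$ (no dotted edges between $a,b$) then set $\Delta:=\mathrm{infl}_b\Delta$; then set $\Delta:=\mathrm{infl}_{b,a}\Delta$; set $S:=S\cup\{b\}$; 3. return $\hat\Delta:=\Delta$. Then this algorithm is correct: every choice required in step 2 exists and every inflation performed is defined, the algorithm terminates, and the returned $\hat\Delta$ is a connected loop-free bigraph with $n$ vertices such that the quadratic form $q_{\hat\Delta}:\mathbb{Z}^n\to\mathbb{Z}$ admits a positive sincere root, and $\Delta$ is positive if and only if $\hat\Delta$ is positive. Moreover, applied to $\Delta$, it performs at most $n-1$ inflations at a vertex and at most $n-1$ inflations at a pair.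
   Context: A loop-free bigraph with vertex set $\{1,\dots,n\}$ is an undirected multigraph without loops whose edges are of two kinds, solid and dotted, such that any two distinct vertices are joined only by edges of one kind. It is encoded by integers $d_{ij}=d_{ji}$ for $i\neq j$: $d_{ij}=-m$ if $i,j$ are joined by $m$ solid edges, $d_{ij}=m$ if joined by $m$ dotted edges ($d_{ij}=0$ if not joined). The bigraph is connected if the underlying graph (all edges regarded as ordinary edges) is connected. Its Gram matrix is the upper triangular integer matrix with $1$'s on the diagonal and entry $d_{ij}$ at $(i,j)$ for $i<j$; the bigraph is positive if its Gram matrix $G$ is positive definite, i.e. $q_\Delta(x):=x^TGx=\sum_i x_i^2+\sum_{i<j}d_{ij}x_ix_j>0$ for all nonzero $x$. Inflation at a vertex $a$: $\mathrm{infl}_a\Delta$ has $d'_{ac}=-d_{ac}$ for all $c\neq a$, all other $d_{ij}$ unchanged. Inflation at a pair $(a,b)$ of distinct vertices, defined only when $d_{ab}>0$: $\mathrm{infl}_{a,b}\Delta$ has $d'_{ab}=-d_{ab}$, $d'_{bc}=d_{bc}-d_{ac}d_{ab}$ for each $c\neq a,b$ (using the values of $\Delta$), and all other $d_{ij}$ unchanged. A vector $v\in\mathbb{Z}^n$ is a root of $q_\Delta$ if $q_\Delta(v)=1$; it is positive if $v\neq0$ and all $v_i\geq 0$, and sincere if all $v_i\neq 0$. *)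

theory Defs imports Complex_Main begin

text \<open>
  A bigraph on the vertices \<open>{1..n}\<close> is given by its integers \<open>d i j\<close>: the value \<open>-m\<close> stands for
  \<open>m\<close> solid edges, \<open>m\<close> for \<open>m\<close> dotted edges. The diagonal is normalised to \<open>0\<close> (no loops), and
  values outside \<open>{1..n}\<close> are never inspected. Vectors of length \<open>n\<close> are likewise functions
  on \<open>nat\<close> of which only the values on \<open>{1..n}\<close> matter.
\<close>

type_synonym bigraph = "nat \<Rightarrow> nat \<Rightarrow> int"

definition loop_free_bigraph :: "nat \<Rightarrow> bigraph \<Rightarrow> bool" where
  "loop_free_bigraph n d \<longleftrightarrow>
     (\<forall>i\<in>{1..n}. d i i = 0) \<and> (\<forall>i\<in>{1..n}. \<forall>j\<in>{1..n}. d i j = d j i)"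

definition adjacency :: "nat \<Rightarrow> bigraph \<Rightarrow> (nat \<times> nat) set" where
  "adjacency n d = {(i, j). i \<in> {1..n} \<and> j \<in> {1..n} \<and> i \<noteq> j \<and> d i j \<noteq> 0}"

definition connected_bigraph :: "nat \<Rightarrow> bigraph \<Rightarrow> bool" where
  "connected_bigraph n d \<longleftrightarrow> (\<forall>i\<in>{1..n}. \<forall>j\<in>{1..n}. (i, j) \<in> (adjacency n d)\<^sup>*)"

definition gram :: "bigraph \<Rightarrow> nat \<Rightarrow> nat \<Rightarrow> int" where
  "gram d i j = (if i = j then 1 else if i < j then d i j else 0)"

text \<open>The form is polymorphic: it is used over the integers for roots and over the reals for
  positive definiteness.\<close>

definition qform :: "nat \<Rightarrow> bigraph \<Rightarrow> (nat \<Rightarrow> 'a::comm_ring_1) \<Rightarrow> 'a" where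
  "qform n d x = (\<Sum>i=1..n. \<Sum>j=1..n. x i * of_int (gram d i j) * x j)"

definition positive_bigraph :: "nat \<Rightarrow> bigraph \<Rightarrow> bool" where
  "positive_bigraph n d \<longleftrightarrow>
     (\<forall>x::nat \<Rightarrow> real. (\<exists>i\<in>{1..n}. x i \<noteq> 0) \<longrightarrow> qform n d x > 0)"

definition is_root :: "nat \<Rightarrow> bigraph \<Rightarrow> (nat \<Rightarrow> int) \<Rightarrow> bool" where
  "is_root n d v \<longleftrightarrow> qform n d v = 1"

definition positive_vector :: "nat \<Rightarrow> (nat \<Rightarrow> int) \<Rightarrow> bool" where
  "positive_vector n v \<longleftrightarrow> (\<exists>i\<in>{1..n}. v i \<noteq> 0) \<and> (\<forall>i\<in>{1..n}. v i \<ge> 0)"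

definition sincere_vector :: "nat \<Rightarrow> (nat \<Rightarrow> int) \<Rightarrow> bool" where
  "sincere_vector n v \<longleftrightarrow> (\<forall>i\<in>{1..n}. v i \<noteq> 0)"

definition infl_vertex :: "nat \<Rightarrow> bigraph \<Rightarrow> bigraph" where
  "infl_vertex a d = (\<lambda>i j. if i \<noteq> j \<and> (i = a \<or> j = a) then - d i j else d i j)"

text \<open>Inflation at a pair is partial; \<open>None\<close> means undefined.\<close>

definition infl_pair :: "nat \<Rightarrow> nat \<Rightarrow> bigraph \<Rightarrow> bigraph option" where
  "infl_pair a b d =
     (if a \<noteq> b \<and> d a b > 0 then
        Some (\<lambda>i j.
          if (i = a \<and> j = b) \<or> (i = b \<and> j = a) then - d a b
          else if i = b \<and> j \<noteq> b then d b j - d a j * d a b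
          else if j = b \<and> i \<noteq> b then d b i - d a i * d a b
          else d i j)
      else None)"

text \<open>
  States of the algorithm at the head of the while loop: the current bigraph, the set \<open>S\<close>, and
  the numbers of inflations at a vertex and at a pair performed so far. The choice of \<open>(a, b)\<close>
  is nondeterministic, so one execution of the loop body is a relation between states. There is no
  transition for a choice whose inflation at a pair is undefined, so definedness has to be
  asserted separately.
\<close>

type_synonym alg_state = "bigraph \<times> nat set \<times> nat \<times> nat"

definition alg_init :: "bigraph \<Rightarrow> alg_state" where
  "alg_init d = (d, {1}, 0, 0)"

definition admissible_choice :: "nat \<Rightarrow> bigraph \<Rightarrow> nat set \<Rightarrow> nat \<Rightarrow> nat \<Rightarrow> bool" where
  "admissible_choice n d S a b \<longleftrightarrow> a \<in> S \<and> b \<in> {1..n} - S \<and> d a b \<noteq> 0"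

definition make_dotted :: "nat \<Rightarrow> nat \<Rightarrow> bigraph \<Rightarrow> bigraph" where
  "make_dotted a b d = (if d a b < 0 then infl_vertex b d else d)"

inductive alg_step :: "nat \<Rightarrow> alg_state \<Rightarrow> alg_state \<Rightarrow> bool" for n :: nat where
  "\<lbrakk>card S < n; admissible_choice n d S a b; infl_pair b a (make_dotted a b d) = Some d'\<rbrakk>
   \<Longrightarrow> alg_step n (d, S, kv, kp)
         (d', S \<union> {b}, kv + (if d a b < 0 then 1 else 0), kp + 1)"

definition alg_reachable :: "nat \<Rightarrow> bigraph \<Rightarrow> alg_state \<Rightarrow> bool" where
  "alg_reachable n d s \<longleftrightarrow> (alg_step n)\<^sup>*\<^sup>* (alg_init d) s"

definition alg_returns :: "nat \<Rightarrow> bigraph \<Rightarrow> bigraph \<Rightarrow> bool" where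
  "alg_returns n d d' \<longleftrightarrow> (\<exists>S kv kp. alg_reachable n d (d', S, kv, kp) \<and> \<not> card S < n)"

definition alg_terminates :: "nat \<Rightarrow> bigraph \<Rightarrow> bool" where
  "alg_terminates n d \<longleftrightarrow>
     \<not> (\<exists>s::nat \<Rightarrow> alg_state. s 0 = alg_init d \<and> (\<forall>k. alg_step n (s k) (s (Suc k))))"

end

theory Submission imports Defs begin

text \<open>
  Both kinds of inflation replace \<open>q\<close> by \<open>q \<circ> T\<close> for an invertible integral substitution \<open>T\<close>
  changing a single coordinate: \<open>x\<^sub>a \<mapsto> - x\<^sub>a\<close> for the inflation at \<open>a\<close>, and
  \<open>x\<^sub>a \<mapsto> x\<^sub>a - d\<^sub>a\<^sub>b x\<^sub>b\<close> for the inflation at \<open>(a, b)\<close>. Hence positivity is preserved. The loop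
  maintains a root \<open>v\<close> which is positive on \<open>S\<close> and vanishes outside: the inflation at \<open>b\<close>
  fixes it because \<open>v\<^sub>b = 0\<close>, and the inverse of the substitution for the pair \<open>(b, a)\<close> sends it to
  the root with new coordinate \<open>d\<^sub>a\<^sub>b v\<^sub>a > 0\<close> at \<open>b\<close>.
\<close>

section \<open>The quadratic form seen from a single vertex, and its behaviour under
  inflations\<close>

text \<open>For \<open>c \<noteq> b\<close> exactly one of \<open>gram d b c\<close>,
  \<open>gram d c b\<close> lies above the diagonal, and by symmetry it equals \<open>d b c\<close>;
  so row and column \<open>b\<close> merge into one linear form. The remaining double sum does not
  see \<open>b\<close>.\<close>

lemma qform_expand:
  assumes "loop_free_bigraph n d" and "b \<in> {1..n}"
  shows "qform n d x = x b * x b + x b * (\<Sum>c\<in>{1..n}-{b}. of_int (d b c) * x c)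
     + (\<Sum>i\<in>{1..n}-{b}. \<Sum>j\<in>{1..n}-{b}. x i * of_int (gram d i j) * x j)"
proof -
  let ?f = "\<lambda>i j. x i * of_int (gram d i j) * x j"
  let ?A = "{1..n} - {b}"
  have row: "(\<Sum>j=1..n. ?f i j) = ?f i b + (\<Sum>j\<in>?A. ?f i j)" for i
    using assms(2) by (intro sum.remove) auto
  have "qform n d x = (\<Sum>j=1..n. ?f b j) + (\<Sum>i\<in>?A. \<Sum>j=1..n. ?f i j)"
    unfolding qform_def using assms(2) by (intro sum.remove) auto
  also have "\<dots> = ?f b b + (\<Sum>c\<in>?A. ?f b c + ?f c b) + (\<Sum>i\<in>?A. \<Sum>j\<in>?A. ?f i j)"
    unfolding row by (simp add: sum.distrib algebra_simps)
  also have "(\<Sum>c\<in>?A. ?f b c + ?f c b) = (\<Sum>c\<in>?A. x b * (of_int (d b c) * x c))"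
  proof (rule sum.cong)
    fix c assume "c \<in> ?A"
    then have "d c b = d b c" "c \<noteq> b"
      using assms unfolding loop_free_bigraph_def by auto
    then show "?f b c + ?f c b = x b * (of_int (d b c) * x c)"
      by (auto simp: gram_def algebra_simps)
  qed simp
  finally show ?thesis
    by (simp add: gram_def sum_distrib_left)
qed

text \<open>The block away from \<open>b\<close> cancels in the difference. This serves both for
  changing the bigraph at \<open>b\<close> with the vector fixed and for changing the vector at
  \<open>b\<close> with the bigraph fixed.\<close>

lemma qform_expand_cong:
  assumes "loop_free_bigraph n d" and "loop_free_bigraph n d'" and "b \<in> {1..n}"
    and "\<And>i j. i \<noteq> b \<Longrightarrow> j \<noteq> b \<Longrightarrow> d' i j = d i j"
    and "\<And>i. i \<noteq> b \<Longrightarrow> x i = y i"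
  shows "qform n d' x - qform n d y =
     x b * x b + x b * (\<Sum>c\<in>{1..n}-{b}. of_int (d' b c) * x c)
     - (y b * y b + y b * (\<Sum>c\<in>{1..n}-{b}. of_int (d b c) * y c))"
proof -
  have "(\<Sum>i\<in>{1..n}-{b}. \<Sum>j\<in>{1..n}-{b}. x i * of_int (gram d' i j) * x j)
      = (\<Sum>i\<in>{1..n}-{b}. \<Sum>j\<in>{1..n}-{b}. y i * of_int (gram d i j) * y j)"
    using assms(4,5) by (intro sum.cong) (auto simp: gram_def)
  then show ?thesis
    unfolding qform_expand[OF assms(1,3)] qform_expand[OF assms(2,3)] by simp
qed

lemma loop_free_infl_vertex:
  "loop_free_bigraph n d \<Longrightarrow> loop_free_bigraph n (infl_vertex a d)"
  unfolding loop_free_bigraph_def infl_vertex_def by auto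

lemma qform_infl_vertex:
  assumes "loop_free_bigraph n d" and "a \<in> {1..n}"
  shows "qform n (infl_vertex a d) x = qform n d (x(a := - x a))"
proof -
  have "(\<Sum>c\<in>{1..n}-{a}. of_int (infl_vertex a d a c) * x c)
      = (\<Sum>c\<in>{1..n}-{a}. - (of_int (d a c) * (x(a := - x a)) c))"
    by (rule sum.cong) (auto simp: infl_vertex_def)
  then have "qform n (infl_vertex a d) x - qform n d (x(a := - x a)) = 0"
    by (subst qform_expand_cong[OF assms(1) loop_free_infl_vertex[OF assms(1)] assms(2)])
       (auto simp: infl_vertex_def sum_negf)
  then show ?thesis by simp
qed

lemma adjacency_infl_vertex: "adjacency n (infl_vertex a d) = adjacency n d"
  unfolding adjacency_def infl_vertex_def by auto

lemma infl_pair_SomeD: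
  assumes "infl_pair a b d = Some d'"
  shows "a \<noteq> b \<and> d a b > 0"
  using assms unfolding infl_pair_def by (cases "a \<noteq> b \<and> d a b > 0") auto

lemma infl_pair_eq:
  assumes "infl_pair a b d = Some d'"
  shows "d' i j = (if (i = a \<and> j = b) \<or> (i = b \<and> j = a) then - d a b
          else if i = b \<and> j \<noteq> b then d b j - d a j * d a b
          else if j = b \<and> i \<noteq> b then d b i - d a i * d a b
          else d i j)"
proof -
  note ab = infl_pair_SomeD[OF assms]
  show ?thesis
    using assms[unfolded infl_pair_def if_P[OF ab] option.inject,
        THEN fun_cong, THEN fun_cong, of i j] by (rule sym)
qed

lemma loop_free_infl_pair:
  assumes "loop_free_bigraph n d" and infl: "infl_pair a b d = Some d'"
  shows "loop_free_bigraph n d'"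
proof -
  have "a \<noteq> b" using infl_pair_SomeD[OF infl] by simp
  then have "d' i i = d i i" for i
    by (simp add: infl_pair_eq[OF infl])
  moreover have "d' i j = d' j i" if "d i j = d j i" for i j
  proof (cases "i = b \<or> j = b")
    case False
    then show ?thesis using that by (simp add: infl_pair_eq[OF infl])
  next
    case True
    then show ?thesis
      by (elim disjE; cases "i = j"; hypsubst) (simp_all add: infl_pair_eq[OF infl])
  qed
  ultimately show ?thesis
    using assms(1) by (simp add: loop_free_bigraph_def)
qed

lemma infl_pair_apply:
  assumes "infl_pair a b d = Some d'"
  shows "a \<noteq> b" and "d a b > 0" and "d' b a = - d a b" and "d' a b = - d a b"
    and "\<And>c. c \<noteq> a \<Longrightarrow> c \<noteq> b \<Longrightarrow> d' b c = d b c - d a c * d a b"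
    and "\<And>i j. i \<noteq> b \<Longrightarrow> j \<noteq> b \<Longrightarrow> d' i j = d i j"
  using infl_pair_SomeD[OF assms] by (simp_all add: infl_pair_eq[OF assms])

text \<open>The bigraph changes in row and column \<open>b\<close>, but the substitution acts on
  coordinate \<open>a\<close>. Each side is therefore compared with \<open>qform n d x\<close>, and
  both differences turn out to be \<open>- t * (2 * x a + La)\<close>.\<close>

lemma qform_infl_pair:
  assumes lf: "loop_free_bigraph n d" and "a \<in> {1..n}" and "b \<in> {1..n}"
    and infl: "infl_pair a b d = Some d'"
  shows "qform n d' x = qform n d (x(a := x a - of_int (d a b) * x b))"
proof -
  note app = infl_pair_apply[OF infl]
  have ba: "d b a = d a b"
    using assms(1-3) unfolding loop_free_bigraph_def by blast
  let ?C = "{1..n} - {a} - {b}"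
  define t where "t = of_int (d a b) * x b"
  define La where "La = (\<Sum>c\<in>?C. of_int (d a c) * x c)"
  define Lb where "Lb = (\<Sum>c\<in>?C. of_int (d b c) * x c)"
  have swap: "{1..n} - {b} - {a} = ?C" by auto
  have "(\<Sum>c\<in>{1..n}-{b}. of_int (d' b c) * x c)
      = of_int (d' b a) * x a + (\<Sum>c\<in>?C. of_int (d' b c) * x c)"
    using assms(2) app(1) by (subst sum.remove[of _ a]) (auto simp: swap[simplified])
  also have "(\<Sum>c\<in>?C. of_int (d' b c) * x c)
      = (\<Sum>c\<in>?C. of_int (d b c) * x c - of_int (d a b) * (of_int (d a c) * x c))"
    by (rule sum.cong) (auto simp: app(5) algebra_simps)
  finally have new_b: "(\<Sum>c\<in>{1..n}-{b}. of_int (d' b c) * x c)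
      = - of_int (d a b) * x a + Lb - of_int (d a b) * La"
    by (simp add: app(3) La_def Lb_def sum_subtractf sum_distrib_left)
  have old_b: "(\<Sum>c\<in>{1..n}-{b}. of_int (d b c) * x c) = of_int (d a b) * x a + Lb"
    using assms(2) app(1) by (subst sum.remove[of _ a]) (auto simp: swap[simplified] Lb_def ba)
  \<comment> \<open>Stated for every \<open>y\<close> agreeing with \<open>x\<close> off
    \<open>a\<close>, so that it covers both \<open>x\<close> and the substituted vector.\<close>
  have old_a: "(\<Sum>c\<in>{1..n}-{a}. of_int (d a c) * y c) = t + La"
    if "\<And>c. c \<noteq> a \<Longrightarrow> y c = x c" for y
    using assms(3) app(1) that by (subst sum.remove[of _ b]) (auto simp: La_def t_def intro!: sum.cong)
  have "qform n d' x - qform n d x = - t * (2 * x a + La)"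
  proof (subst qform_expand_cong[OF lf loop_free_infl_pair[OF lf infl] assms(3)])
    show "x b * x b + x b * (\<Sum>c\<in>{1..n}-{b}. of_int (d' b c) * x c)
      - (x b * x b + x b * (\<Sum>c\<in>{1..n}-{b}. of_int (d b c) * x c)) = - t * (2 * x a + La)"
      unfolding new_b old_b by (simp add: t_def algebra_simps)
  qed (simp_all add: app(6))
  moreover have "qform n d (x(a := x a - t)) - qform n d x = - t * (2 * x a + La)"
  proof (subst qform_expand_cong[OF lf lf assms(2)])
    show "(x(a := x a - t)) a * (x(a := x a - t)) a +
      (x(a := x a - t)) a * (\<Sum>c\<in>{1..n}-{a}. of_int (d a c) * (x(a := x a - t)) c) -
      (x a * x a + x a * (\<Sum>c\<in>{1..n}-{a}. of_int (d a c) * x c)) = - t * (2 * x a + La)"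
      by (subst (1 2) old_a) (simp_all add: algebra_simps)
  qed simp_all
  ultimately show ?thesis
    unfolding t_def[symmetric] by (simp add: diff_eq_eq)
qed

section \<open>Preservation of connectedness\<close>

text \<open>Inflation at a pair may delete edges, so old edges are only required to be replaced by
  walks; walks of walks are walks.\<close>

lemma connected_bigraph_mono:
  assumes "connected_bigraph n d" and "adjacency n d \<subseteq> (adjacency n d')\<^sup>*"
  shows "connected_bigraph n d'"
  using assms(1) rtrancl_subset_rtrancl[OF assms(2)]
  unfolding connected_bigraph_def by blast

text \<open>An edge between \<open>b\<close> and \<open>c\<close> can disappear only if \<open>d\<^sub>a\<^sub>c \<noteq> 0\<close>, and then \<open>a\<close> still joins
  \<open>b\<close> to \<open>c\<close>.\<close>

lemma connected_infl_pair:
  assumes lf: "loop_free_bigraph n d" and a: "a \<in> {1..n}" and b: "b \<in> {1..n}"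
    and infl: "infl_pair a b d = Some d'" and con: "connected_bigraph n d"
  shows "connected_bigraph n d'"
proof (rule connected_bigraph_mono[OF con], safe)
  note app = infl_pair_apply[OF infl]
  have lf': "loop_free_bigraph n d'" by (rule loop_free_infl_pair[OF lf infl])
  have symm: "d i j = d j i" "d' i j = d' j i" if "i \<in> {1..n}" "j \<in> {1..n}" for i j
    using that lf lf' unfolding loop_free_bigraph_def by blast+
  have sym: "sym (adjacency n d')"
    unfolding sym_def adjacency_def using symm by auto
  have ab: "(b, a) \<in> adjacency n d'"
    using a b app(1-3) unfolding adjacency_def by auto
  have from_b: "(b, c) \<in> (adjacency n d')\<^sup>*" if c: "c \<in> {1..n}" "c \<noteq> b" "d b c \<noteq> 0" for c
  proof (cases "c = a \<or> d' b c \<noteq> 0")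
    case True
    then show ?thesis using ab c b by (auto simp: adjacency_def)
  next
    case False
    then have "d a c \<noteq> 0" using app(5)[of c] c by auto
    then have "(a, c) \<in> adjacency n d'"
      using a c False app(1) app(6)[of a c] by (auto simp: adjacency_def)
    then show ?thesis using ab by (meson converse_rtrancl_into_rtrancl r_into_rtrancl)
  qed
  fix i j assume ij: "(i, j) \<in> adjacency n d"
  then have ij': "i \<in> {1..n}" "j \<in> {1..n}" "i \<noteq> j" "d i j \<noteq> 0"
    by (auto simp: adjacency_def)
  consider "i = b" | "j = b" | "i \<noteq> b" "j \<noteq> b" by blast
  then show "(i, j) \<in> (adjacency n d')\<^sup>*"
  proof cases
    case 1
    then show ?thesis using from_b ij' by auto
  next
    case 2
    then have "(j, i) \<in> (adjacency n d')\<^sup>*"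
      using from_b[of i] ij' symm(1)[of i j] by auto
    then show ?thesis using sym_rtrancl[OF sym] by (meson symD)
  next
    case 3
    then have "(i, j) \<in> adjacency n d'"
      using ij' app(6) by (auto simp: adjacency_def)
    then show ?thesis by auto
  qed
qed

section \<open>Preservation of positivity\<close>

text \<open>One direction only: \<open>T\<close> has to keep nonzero vectors nonzero. The
  equivalences below apply it to a substitution and to its inverse.\<close>

lemma positive_bigraph_transfer:
  assumes "\<And>x :: nat \<Rightarrow> real. qform n d' x = qform n d (T x)"
    and "\<And>x. \<exists>i\<in>{1..n}. x i \<noteq> 0 \<Longrightarrow> \<exists>i\<in>{1..n}. T x i \<noteq> 0"
    and "positive_bigraph n d"
  shows "positive_bigraph n d'"
  using assms unfolding positive_bigraph_def by simp

lemma positive_infl_vertex: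
  assumes "loop_free_bigraph n d" and "a \<in> {1..n}"
  shows "positive_bigraph n (infl_vertex a d) \<longleftrightarrow> positive_bigraph n d"
proof
  have nz: "\<exists>i\<in>{1..n}. (x(a := - x a)) i \<noteq> 0" if "\<exists>i\<in>{1..n}. x i \<noteq> 0" for x :: "nat \<Rightarrow> real"
    using that by auto
  show "positive_bigraph n (infl_vertex a d)" if "positive_bigraph n d"
    by (rule positive_bigraph_transfer[OF qform_infl_vertex[OF assms] nz that])
  \<comment> \<open>The sign change is an involution, so it is its own inverse.\<close>
  have "qform n d x = qform n (infl_vertex a d) (x(a := - x a))" for x :: "nat \<Rightarrow> real"
    by (simp add: qform_infl_vertex[OF assms])
  then show "positive_bigraph n d" if "positive_bigraph n (infl_vertex a d)"
    by (rule positive_bigraph_transfer[OF _ nz that])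
qed

lemma positive_infl_pair:
  assumes "loop_free_bigraph n d" and "a \<in> {1..n}" and b: "b \<in> {1..n}"
    and infl: "infl_pair a b d = Some d'"
  shows "positive_bigraph n d' \<longleftrightarrow> positive_bigraph n d"
proof
  have ab: "a \<noteq> b" by (rule infl_pair_apply(1)[OF infl])
  \<comment> \<open>The free \<open>k\<close> covers the substitution (\<open>k\<close> is minus
    \<open>d a b\<close>) and its inverse (\<open>k\<close> is \<open>d a b\<close>). If
    \<open>x b = 0\<close> the vector is unchanged; otherwise coordinate \<open>b\<close>
    survives.\<close>
  have nz: "\<exists>i\<in>{1..n}. (x(a := x a + k * x b)) i \<noteq> 0"
    if "\<exists>i\<in>{1..n}. x i \<noteq> 0" for x :: "nat \<Rightarrow> real" and k
  proof (cases "x b = 0")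
    case True
    then show ?thesis using that by auto
  next
    case False
    then show ?thesis using ab b by (intro bexI[of _ b]) auto
  qed
  have q: "qform n d' x = qform n d (x(a := x a + - of_int (d a b) * x b))" for x :: "nat \<Rightarrow> real"
    by (simp add: qform_infl_pair[OF assms])
  show "positive_bigraph n d'" if "positive_bigraph n d"
    by (rule positive_bigraph_transfer[OF q nz that])
  have "qform n d x = qform n d' (x(a := x a + of_int (d a b) * x b))" for x :: "nat \<Rightarrow> real"
    using ab by (simp add: q)
  then show "positive_bigraph n d" if "positive_bigraph n d'"
    by (rule positive_bigraph_transfer[OF _ nz that])
qed

section \<open>The loop invariant\<close>

text \<open>\<open>d\<^sub>0\<close> is the input bigraph. The clause \<open>card S = Suc kp\<close>
  ties the pair counter to the size of \<open>S\<close>; it yields termination and, with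
  \<open>kv \<le> kp\<close>, both bounds on the counters.\<close>

definition alg_invariant :: "nat \<Rightarrow> bigraph \<Rightarrow> alg_state \<Rightarrow> bool" where
  "alg_invariant n d\<^sub>0 s \<longleftrightarrow> (case s of (d, S, kv, kp) \<Rightarrow>
     loop_free_bigraph n d \<and> connected_bigraph n d \<and>
     (positive_bigraph n d\<^sub>0 \<longleftrightarrow> positive_bigraph n d) \<and>
     S \<subseteq> {1..n} \<and> 1 \<in> S \<and> card S = Suc kp \<and> kv \<le> kp \<and>
     (\<exists>v. is_root n d v \<and> (\<forall>i\<in>S. v i > 0) \<and> (\<forall>i\<in>{1..n}-S. v i = 0)))"

lemma alg_invariant_init:
  assumes "n \<ge> 1" and "loop_free_bigraph n d" and "connected_bigraph n d"
  shows "alg_invariant n d (alg_init d)"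
proof -
  \<comment> \<open>The unit vector at vertex 1: only its diagonal term contributes to the
    form.\<close>
  define v :: "nat \<Rightarrow> int" where "v = (\<lambda>i. if i = 1 then 1 else 0)"
  have one: "1 \<in> {1..n}" using assms(1) by simp
  have "qform n d v = 1"
    unfolding qform_expand[OF assms(2) one] by (simp add: v_def)
  then have "is_root n d v \<and> (\<forall>i\<in>{1}. v i > 0) \<and> (\<forall>i\<in>{1..n}-{1}. v i = 0)"
    by (simp add: is_root_def v_def)
  then show ?thesis
    using assms unfolding alg_invariant_def alg_init_def by auto
qed

text \<open>Prepares the inflation at \<open>(b, a)\<close>: the optional sign flip at
  \<open>b\<close> makes it defined, and a vector vanishing at \<open>b\<close> is fixed by the
  flip, hence so is its value under the form.\<close>

lemma make_dotted_props:
  assumes "loop_free_bigraph n d" and "a \<in> {1..n}" and "b \<in> {1..n}" and "a \<noteq> b" and "d a b \<noteq> 0"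
  shows "loop_free_bigraph n (make_dotted a b d)"
    and "connected_bigraph n (make_dotted a b d) \<longleftrightarrow> connected_bigraph n d"
    and "positive_bigraph n (make_dotted a b d) \<longleftrightarrow> positive_bigraph n d"
    and "x b = 0 \<Longrightarrow> qform n (make_dotted a b d) x = qform n d x"
    and "make_dotted a b d b a > 0"
proof -
  have ba: "d b a = d a b"
    using assms(1-3) unfolding loop_free_bigraph_def by blast
  show "loop_free_bigraph n (make_dotted a b d)"
    using assms(1) loop_free_infl_vertex by (auto simp: make_dotted_def)
  show "connected_bigraph n (make_dotted a b d) \<longleftrightarrow> connected_bigraph n d"
    by (simp add: make_dotted_def connected_bigraph_def adjacency_infl_vertex)
  show "positive_bigraph n (make_dotted a b d) \<longleftrightarrow> positive_bigraph n d"
    using positive_infl_vertex[OF assms(1,3)] by (simp add: make_dotted_def)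
  show "qform n (make_dotted a b d) x = qform n d x" if "x b = 0"
  proof -
    have "x(b := - x b) = x" using that by auto
    then show ?thesis using qform_infl_vertex[OF assms(1,3), of x] by (simp add: make_dotted_def)
  qed
  show "make_dotted a b d b a > 0"
    using assms(4,5) ba by (auto simp: make_dotted_def infl_vertex_def)
qed

lemma alg_invariant_step:
  assumes "alg_step n s s'" and "alg_invariant n d\<^sub>0 s"
  shows "alg_invariant n d\<^sub>0 s'"
  using assms
proof (cases rule: alg_step.cases)
  case (1 S d a b d' kv kp)
  have inv: "loop_free_bigraph n d" "connected_bigraph n d"
      "positive_bigraph n d\<^sub>0 \<longleftrightarrow> positive_bigraph n d"
      "S \<subseteq> {1..n}" "1 \<in> S" "card S = Suc kp" "kv \<le> kp"
    using assms(2) unfolding 1(1) alg_invariant_def by auto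
  obtain v where v: "is_root n d v" "\<forall>i\<in>S. v i > 0" "\<forall>i\<in>{1..n}-S. v i = 0"
    using assms(2) unfolding 1(1) alg_invariant_def by auto
  have ch: "a \<in> S" "b \<in> {1..n}" "b \<notin> S" "d a b \<noteq> 0"
    using 1(4) by (auto simp: admissible_choice_def)
  then have ab: "a \<in> {1..n}" "a \<noteq> b" using inv(4) by auto
  define e where "e = make_dotted a b d"
  note e = make_dotted_props[OF inv(1) ab(1) ch(2) ab(2) ch(4), folded e_def]
  have infl: "infl_pair b a e = Some d'" using 1(5) by (simp add: e_def)
  \<comment> \<open>The inverse substitution
    \<open>x\<^sub>b \<mapsto> x\<^sub>b + e\<^sub>b\<^sub>a x\<^sub>a\<close> applied to
    \<open>v\<close>, simplified by \<open>v b = 0\<close>. The bigraph changes at \<open>a\<close>,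
    the root at \<open>b\<close>.\<close>
  define w where "w = v(b := e b a * v a)"
  have w_back: "w(b := w b - of_int (e b a) * w a) = v"
    using ab(2) ch(2,3) v(3) by (auto simp: w_def)
  have "is_root n d' w"
    unfolding is_root_def qform_infl_pair[OF e(1) ch(2) ab(1) infl] w_back
    using e(4)[of v] v(1,3) ch(2,3) by (simp add: is_root_def)
  moreover have "\<forall>i\<in>S \<union> {b}. w i > 0"
    using v(2) ch(1) e(5) by (auto simp: w_def)
  moreover have "\<forall>i\<in>{1..n} - (S \<union> {b}). w i = 0"
    using v(3) by (auto simp: w_def)
  ultimately have "\<exists>w. is_root n d' w \<and> (\<forall>i\<in>S \<union> {b}. w i > 0) \<and> (\<forall>i\<in>{1..n} - (S \<union> {b}). w i = 0)"
    by blast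
  moreover have "card (S \<union> {b}) = Suc (kp + 1)"
    using inv(4,6) ch(3) finite_subset[OF inv(4)] by simp
  ultimately show ?thesis
    unfolding 1(2) alg_invariant_def
    using inv ch(2) loop_free_infl_pair[OF e(1) infl]
      connected_infl_pair[OF e(1) ch(2) ab(1) infl] e(2,3)
      positive_infl_pair[OF e(1) ch(2) ab(1) infl]
    by auto
qed

section \<open>Progress of the loop and correctness of its result\<close>

text \<open>Without a choice, \<open>S\<close> is closed under adjacency; as it contains 1,
  connectedness puts every vertex into it, although \<open>card S < n\<close> leaves one
  outside.\<close>

lemma admissible_choice_exists:
  assumes "alg_invariant n d\<^sub>0 (d, S, kv, kp)" and "card S < n"
  shows "\<exists>a b. admissible_choice n d S a b"
proof (rule ccontr)
  assume no: "\<nexists>a b. admissible_choice n d S a b"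
  have inv: "connected_bigraph n d" "S \<subseteq> {1..n}" "1 \<in> S"
    using assms(1) unfolding alg_invariant_def by auto
  have "S \<noteq> {1..n}" using assms(2) by auto
  then obtain c where c: "c \<in> {1..n}" "c \<notin> S" using inv(2) by blast
  have "(1, c) \<in> (adjacency n d)\<^sup>*"
    using inv c(1) unfolding connected_bigraph_def by blast
  then have "c \<in> S"
  proof induction
    case base
    show ?case by (rule inv(3))
  next
    case (step y z)
    then show ?case using no by (auto simp: adjacency_def admissible_choice_def)
  qed
  with c(2) show False by simp
qed

lemma infl_pair_defined:
  assumes "alg_invariant n d\<^sub>0 (d, S, kv, kp)" and "admissible_choice n d S a b"
  shows "infl_pair b a (make_dotted a b d) \<noteq> None"
proof -
  have "loop_free_bigraph n d" "a \<in> {1..n}" "b \<in> {1..n}" "a \<noteq> b" "d a b \<noteq> 0"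
    using assms unfolding alg_invariant_def admissible_choice_def by auto
  from make_dotted_props(5)[OF this] \<open>a \<noteq> b\<close> show ?thesis by (simp add: infl_pair_def)
qed

theorem theorem4p4:
  fixes n :: nat and d :: bigraph
  assumes "n \<ge> 1" and "loop_free_bigraph n d" and "connected_bigraph n d"
  shows "(\<forall>d' S kv kp. alg_reachable n d (d', S, kv, kp) \<and> card S < n \<longrightarrow>
            (\<exists>a b. admissible_choice n d' S a b) \<and>
            (\<forall>a b. admissible_choice n d' S a b \<longrightarrow>
               infl_pair b a (make_dotted a b d') \<noteq> None)) \<and>
         alg_terminates n d \<and>
         (\<exists>d'. alg_returns n d d') \<and>
         (\<forall>d'. alg_returns n d d' \<longrightarrow>
            loop_free_bigraph n d' \<and> connected_bigraph n d' \<and>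
            (\<exists>v. is_root n d' v \<and> positive_vector n v \<and> sincere_vector n v) \<and>
            (positive_bigraph n d \<longleftrightarrow> positive_bigraph n d')) \<and>
         (\<forall>d' S kv kp. alg_reachable n d (d', S, kv, kp) \<longrightarrow> kv \<le> n - 1 \<and> kp \<le> n - 1)"
proof -
  have inv: "alg_invariant n d s" if "alg_reachable n d s" for s
    using that unfolding alg_reachable_def
    by induction (auto intro: alg_invariant_init[OF assms] alg_invariant_step)
  have bounds: "kv \<le> n - 1 \<and> kp \<le> n - 1" if "alg_reachable n d (d', S, kv, kp)" for d' S kv kp
  proof -
    have "S \<subseteq> {1..n}" "card S = Suc kp" "kv \<le> kp"
      using inv[OF that] unfolding alg_invariant_def by auto
    then show ?thesis using card_mono[of "{1..n}" S] by auto
  qed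
  have terminates: "alg_terminates n d"
    unfolding alg_terminates_def
  proof
    assume "\<exists>s. s 0 = alg_init d \<and> (\<forall>k. alg_step n (s k) (s (Suc k)))"
    then obtain s where s: "s 0 = alg_init d" "\<And>k. alg_step n (s k) (s (Suc k))" by blast
    \<comment> \<open>The pair counter equals the number of steps taken, so after \<open>n\<close>
      steps it would exceed its bound \<open>n - 1\<close>.\<close>
    have "alg_reachable n d (s k) \<and> snd (snd (snd (s k))) = k" for k
    proof (induction k)
      case 0
      show ?case using s(1) by (simp add: alg_reachable_def alg_init_def)
    next
      case (Suc k)
      then show ?case using s(2)[of k]
        unfolding alg_reachable_def by (auto elim: alg_step.cases intro: rtranclp.rtrancl_into_rtrancl)
    qed
    then have "alg_reachable n d (s n)" "snd (snd (snd (s n))) = n" by blast+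
    then show False using bounds assms(1) by (cases "s n") fastforce
  qed
  \<comment> \<open>A run of exactly \<open>k\<close> steps is built for each \<open>k < n\<close>.
    At \<open>k = n - 1\<close> the invariant gives \<open>card S = n\<close>, so the loop exits
    there.\<close>
  have "\<exists>d' S kv. alg_reachable n d (d', S, kv, k)" if "k < n" for k
    using that
  proof (induction k)
    case 0
    show ?case by (auto simp: alg_reachable_def alg_init_def)
  next
    case (Suc k)
    then obtain d' S kv where r: "alg_reachable n d (d', S, kv, k)" by auto
    have "card S < n" using inv[OF r] Suc.prems by (simp add: alg_invariant_def)
    moreover from this obtain a b where ab: "admissible_choice n d' S a b"
      using admissible_choice_exists[OF inv[OF r]] by blast
    moreover obtain d'' where "infl_pair b a (make_dotted a b d') = Some d''"
      using infl_pair_defined[OF inv[OF r] ab] by blast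
    ultimately have "alg_step n (d', S, kv, k)
        (d'', S \<union> {b}, kv + (if d' a b < 0 then 1 else 0), k + 1)"
      by (rule alg_step.intros)
    then show ?case
      using r unfolding alg_reachable_def by (metis Suc_eq_plus1 rtranclp.rtrancl_into_rtrancl)
  qed
  from this[of "n - 1"] assms(1) obtain d' S kv where r: "alg_reachable n d (d', S, kv, n - 1)"
    by auto
  have "\<not> card S < n" using inv[OF r] by (auto simp: alg_invariant_def)
  with r have returns: "\<exists>d'. alg_returns n d d'"
    unfolding alg_returns_def by blast
  have correct: "loop_free_bigraph n d' \<and> connected_bigraph n d' \<and>
      (\<exists>v. is_root n d' v \<and> positive_vector n v \<and> sincere_vector n v) \<and>
      (positive_bigraph n d \<longleftrightarrow> positive_bigraph n d')" if ret: "alg_returns n d d'" for d'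
  proof -
    obtain S kv kp where S: "alg_reachable n d (d', S, kv, kp)" "\<not> card S < n"
      using ret unfolding alg_returns_def by blast
    have I: "loop_free_bigraph n d'" "connected_bigraph n d'"
        "positive_bigraph n d \<longleftrightarrow> positive_bigraph n d'" "S \<subseteq> {1..n}"
      using inv[OF S(1)] unfolding alg_invariant_def by auto
    \<comment> \<open>Once \<open>S\<close> is everything, the invariant's root is strictly positive
      at all vertices, hence positive and sincere; vertex 1 witnesses that it is nonzero.\<close>
    have "S = {1..n}" using I(4) S(2) by (intro card_seteq) auto
    then obtain v where v: "is_root n d' v" "\<forall>i\<in>{1..n}. v i > 0"
      using inv[OF S(1)] unfolding alg_invariant_def by auto
    have "positive_vector n v \<and> sincere_vector n v"
      unfolding positive_vector_def sincere_vector_def using v(2) assms(1)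
      by (auto intro!: bexI[of _ 1] less_imp_le simp: less_imp_neq[symmetric])
    with v(1) I(1-3) show ?thesis by blast
  qed
  show ?thesis
    using inv admissible_choice_exists infl_pair_defined terminates returns correct bounds
    by blast
qed

end
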